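(* Let $P$ be an infinite field, $X$ a finite set, and $F(X)$ the free Lie algebra over $P$ on $X$. Then any linearly stable automorphism $\xi$ of the semigroup $\mathrm{End}(F(X))$ is inner, i.e. there is $f\in\mathrm{Aut}(F(X))$ with $\xi(\varphi)=f\varphi f^{-1}$ for all $\varphi\in\mathrm{End}(F(X))$.
   Context: $\mathrm{End}(F(X))$ is the semigroup of Lie $P$-algebra endomorphisms of $F(X)$ and $\mathrm{Aut}(F(X))$ its group of invertible elements. $\mathrm{Aut}_l(F(X))$ is the group of linear automorphisms of $F(X)$, i.e. those automorphisms sending every $x\in X$ to a $P$-linear combination of elements of $X$. An automorphism $\xi$ of the semigroup $\mathrm{End}(F(X))$ is linearly stable if $\xi(g)=g$ for every $g\in\mathrm{Aut}_l(F(X))$. *)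

theory Defs
  imports Complex_Main "HOL-Algebra.Group" "HOL-Library.FuncSet"
begin

section \<open>Lie algebras\<close>

locale lie_algebra = vector_space scale
  for scale :: "'p::field \<Rightarrow> 'l::ab_group_add \<Rightarrow> 'l" +
  fixes bracket :: "'l \<Rightarrow> 'l \<Rightarrow> 'l"
  assumes bracket_add_left: "bracket (u + v) w = bracket u w + bracket v w"
    and bracket_add_right: "bracket u (v + w) = bracket u v + bracket u w"
    and bracket_scale_left: "bracket (scale c u) v = scale c (bracket u v)"
    and bracket_scale_right: "bracket u (scale c v) = scale c (bracket u v)"
    and bracket_self: "bracket u u = 0"
    and jacobi: "bracket u (bracket v w) + bracket v (bracket w u) + bracket w (bracket u v) = 0"

definition lie_hom_on ::
  "'a set \<Rightarrow> ('p::field \<Rightarrow> 'a::ab_group_add \<Rightarrow> 'a) \<Rightarrow> ('a \<Rightarrow> 'a \<Rightarrow> 'a)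
    \<Rightarrow> ('p \<Rightarrow> 'b::ab_group_add \<Rightarrow> 'b) \<Rightarrow> ('b \<Rightarrow> 'b \<Rightarrow> 'b) \<Rightarrow> ('a \<Rightarrow> 'b) \<Rightarrow> bool"
  where "lie_hom_on S sc br sc' br' f \<longleftrightarrow>
    (\<forall>u\<in>S. \<forall>v\<in>S. f (u + v) = f u + f v) \<and>
    (\<forall>c. \<forall>u\<in>S. f (sc c u) = sc' c (f u)) \<and>
    (\<forall>u\<in>S. \<forall>v\<in>S. f (br u v) = br' (f u) (f v))"

section \<open>The free Lie algebra\<close>

text \<open>The free Lie algebra is built as the algebra of all formal Lie algebra expressions
  modulo the least congruence that contains the Lie algebra axioms.\<close>

datatype ('x, 'p) lie_term =
    TGen 'x
  | TZero
  | TAdd "('x, 'p) lie_term" "('x, 'p) lie_term"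
  | TScale 'p "('x, 'p) lie_term"
  | TBracket "('x, 'p) lie_term" "('x, 'p) lie_term"

inductive lie_eq :: "('x, 'p::field) lie_term \<Rightarrow> ('x, 'p) lie_term \<Rightarrow> bool" where
  refl: "lie_eq s s"
| sym: "lie_eq s t \<Longrightarrow> lie_eq t s"
| trans: "lie_eq s t \<Longrightarrow> lie_eq t r \<Longrightarrow> lie_eq s r"
| cong_add: "lie_eq s s' \<Longrightarrow> lie_eq t t' \<Longrightarrow> lie_eq (TAdd s t) (TAdd s' t')"
| cong_scale: "lie_eq s s' \<Longrightarrow> lie_eq (TScale c s) (TScale c s')"
| cong_bracket: "lie_eq s s' \<Longrightarrow> lie_eq t t' \<Longrightarrow> lie_eq (TBracket s t) (TBracket s' t')"
| add_assoc: "lie_eq (TAdd (TAdd s t) r) (TAdd s (TAdd t r))"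
| add_commute: "lie_eq (TAdd s t) (TAdd t s)"
| add_zero: "lie_eq (TAdd TZero s) s"
| add_neg: "lie_eq (TAdd (TScale (- 1) s) s) TZero"
| scale_add_right: "lie_eq (TScale c (TAdd s t)) (TAdd (TScale c s) (TScale c t))"
| scale_add_left: "lie_eq (TScale (c + d) s) (TAdd (TScale c s) (TScale d s))"
| scale_scale: "lie_eq (TScale c (TScale d s)) (TScale (c * d) s)"
| scale_one: "lie_eq (TScale 1 s) s"
| bracket_add_left: "lie_eq (TBracket (TAdd s t) r) (TAdd (TBracket s r) (TBracket t r))"
| bracket_add_right: "lie_eq (TBracket s (TAdd t r)) (TAdd (TBracket s t) (TBracket s r))"
| bracket_scale_left: "lie_eq (TBracket (TScale c s) t) (TScale c (TBracket s t))"
| bracket_scale_right: "lie_eq (TBracket s (TScale c t)) (TScale c (TBracket s t))"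
| bracket_self: "lie_eq (TBracket s s) TZero"
| jacobi: "lie_eq (TAdd (TAdd (TBracket s (TBracket t r)) (TBracket t (TBracket r s)))
                        (TBracket r (TBracket s t))) TZero"

quotient_type (overloaded) ('x, 'p) free_lie = "('x, 'p::field) lie_term" / lie_eq
  by (rule equivpI)
    (auto intro!: reflpI sympI transpI intro: lie_eq.refl lie_eq.sym lie_eq.trans)

lift_definition lgen :: "'x \<Rightarrow> ('x, 'p::field) free_lie" is TGen .
lift_definition lscale :: "'p \<Rightarrow> ('x, 'p::field) free_lie \<Rightarrow> ('x, 'p) free_lie" is TScale
  by (rule lie_eq.cong_scale)
lift_definition lbracket :: "('x, 'p::field) free_lie \<Rightarrow> ('x, 'p) free_lie \<Rightarrow> ('x, 'p) free_lie"
  is TBracket by (rule lie_eq.cong_bracket)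

instantiation free_lie :: (type, field) ab_group_add
begin

lift_definition zero_free_lie :: "('a, 'b) free_lie" is TZero .
lift_definition plus_free_lie :: "('a, 'b) free_lie \<Rightarrow> ('a, 'b) free_lie \<Rightarrow> ('a, 'b) free_lie"
  is TAdd by (rule lie_eq.cong_add)
definition uminus_free_lie :: "('a, 'b) free_lie \<Rightarrow> ('a, 'b) free_lie"
  where "- u = lscale (- 1) u"
definition minus_free_lie :: "('a, 'b) free_lie \<Rightarrow> ('a, 'b) free_lie \<Rightarrow> ('a, 'b) free_lie"
  where "u - v = u + - (v :: ('a, 'b) free_lie)"

instance
proof
  fix a b c :: "('a, 'b) free_lie"
  show "a + b + c = a + (b + c)" by transfer (rule lie_eq.add_assoc)
  show "a + b = b + a" by transfer (rule lie_eq.add_commute)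
  show "0 + a = a" by transfer (rule lie_eq.add_zero)
  show "- a + a = 0" unfolding uminus_free_lie_def by transfer (rule lie_eq.add_neg)
  show "a - b = a + - b" by (rule minus_free_lie_def)
qed

end

interpretation free_lie: lie_algebra "lscale :: 'p::field \<Rightarrow> ('x, 'p) free_lie \<Rightarrow> _" lbracket
proof
  fix a b :: 'p and u v w :: "('x, 'p) free_lie"
  show "lscale a (u + v) = lscale a u + lscale a v" by transfer (rule lie_eq.scale_add_right)
  show "lscale (a + b) u = lscale a u + lscale b u" by transfer (rule lie_eq.scale_add_left)
  show "lscale a (lscale b u) = lscale (a * b) u" by transfer (rule lie_eq.scale_scale)
  show "lscale 1 u = u" by transfer (rule lie_eq.scale_one)
  show "lbracket (u + v) w = lbracket u w + lbracket v w"
    by transfer (rule lie_eq.bracket_add_left)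
  show "lbracket u (v + w) = lbracket u v + lbracket u w"
    by transfer (rule lie_eq.bracket_add_right)
  show "lbracket (lscale a u) v = lscale a (lbracket u v)"
    by transfer (rule lie_eq.bracket_scale_left)
  show "lbracket u (lscale a v) = lscale a (lbracket u v)"
    by transfer (rule lie_eq.bracket_scale_right)
  show "lbracket u u = 0" by transfer (rule lie_eq.bracket_self)
  show "lbracket u (lbracket v w) + lbracket v (lbracket w u) + lbracket w (lbracket u v) = 0"
    by transfer (rule lie_eq.jacobi)
qed

text \<open>\<open>('x, 'p) free_lie\<close> is free on the whole type \<open>'x\<close>. For a set \<open>X\<close> of generators (possibly
  empty, which a type of generators could not express), \<open>F(X)\<close> is the set of elements
  given by the expressions in the generators from \<open>X\<close>. It has the universal property of the
  free Lie algebra on \<open>X\<close>: see \<open>free_lie_on_universal\<close> below.\<close>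

inductive_set free_lie_on :: "'x set \<Rightarrow> ('x, 'p::field) free_lie set" for X :: "'x set" where
  gen: "x \<in> X \<Longrightarrow> lgen x \<in> free_lie_on X"
| zero: "0 \<in> free_lie_on X"
| add: "u \<in> free_lie_on X \<Longrightarrow> v \<in> free_lie_on X \<Longrightarrow> u + v \<in> free_lie_on X"
| scale: "u \<in> free_lie_on X \<Longrightarrow> lscale c u \<in> free_lie_on X"
| bracket: "u \<in> free_lie_on X \<Longrightarrow> v \<in> free_lie_on X \<Longrightarrow> lbracket u v \<in> free_lie_on X"

context lie_algebra
begin

primrec lie_eval :: "('x \<Rightarrow> 'l) \<Rightarrow> ('x, 'p) lie_term \<Rightarrow> 'l" where
  "lie_eval g (TGen x) = g x"
| "lie_eval g TZero = 0"
| "lie_eval g (TAdd s t) = lie_eval g s + lie_eval g t"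
| "lie_eval g (TScale c s) = scale c (lie_eval g s)"
| "lie_eval g (TBracket s t) = bracket (lie_eval g s) (lie_eval g t)"

lemma lie_eval_cong: "lie_eq s t \<Longrightarrow> lie_eval g s = lie_eval g t"
proof (induction rule: lie_eq.induct)
  case (jacobi s t r)
  show ?case using lie_algebra.jacobi[OF lie_algebra_axioms] by simp
qed (simp_all add: bracket_add_left bracket_add_right bracket_scale_left bracket_scale_right
      bracket_self scale_right_distrib scale_left_distrib ac_simps)

lemma free_lie_on_universal:
  "\<exists>h. lie_hom_on (free_lie_on X) lscale lbracket scale bracket h \<and> (\<forall>x\<in>X. h (lgen x) = g x) \<and>
    (\<forall>h'. lie_hom_on (free_lie_on X) lscale lbracket scale bracket h' \<and>
      (\<forall>x\<in>X. h' (lgen x) = g x) \<longrightarrow> (\<forall>u\<in>free_lie_on X. h' u = h u))"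
proof -
  define h where "h u = lie_eval g (rep_free_lie u)" for u
  have h_abs: "h (abs_free_lie t) = lie_eval g t" for t
    unfolding h_def
    by (rule lie_eval_cong) (metis Quotient3_free_lie rep_abs_rsp_left lie_eq.refl)
  have "h (u + v) = h u + h v" for u v
    by (induct u rule: free_lie.abs_induct; induct v rule: free_lie.abs_induct) (simp add: h_abs plus_free_lie.abs_eq)
  moreover have h_scale: "h (lscale c u) = scale c (h u)" for c u
    by (induct u rule: free_lie.abs_induct) (simp add: h_abs lscale.abs_eq)
  moreover have "h (lbracket u v) = bracket (h u) (h v)" for u v
    by (induct u rule: free_lie.abs_induct; induct v rule: free_lie.abs_induct) (simp add: h_abs lbracket.abs_eq)
  ultimately have hom: "lie_hom_on (free_lie_on X) lscale lbracket scale bracket h"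
    by (simp add: lie_hom_on_def)
  have gen: "h (lgen x) = g x" for x
    by (simp add: h_abs lgen.abs_eq)
  have "h' u = h u"
    if h': "lie_hom_on (free_lie_on X) lscale lbracket scale bracket h'"
      and g': "\<forall>x\<in>X. h' (lgen x) = g x" and u: "u \<in> free_lie_on X" for h' u
    using u
  proof (induction rule: free_lie_on.induct)
    case zero
    have k0: "k 0 = 0" if "lie_hom_on (free_lie_on X) lscale lbracket scale bracket k" for k
    proof -
      have "k (0 + 0) = k 0 + k 0"
        using that free_lie_on.zero unfolding lie_hom_on_def by blast
      then show ?thesis by simp
    qed
    show ?case using k0[OF h'] k0[OF hom] by simp
  qed (use h' hom g' gen in \<open>simp_all add: lie_hom_on_def\<close>)
  then show ?thesis using hom gen by blast
qed

end

section \<open>The semigroup of endomorphisms\<close>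

text \<open>Endomorphisms of \<open>F(X)\<close> are represented by functions that are \<open>undefined\<close> outside \<open>F(X)\<close>,
  so that equality of functions is equality of endomorphisms.\<close>

definition lie_End :: "'x set \<Rightarrow> (('x, 'p::field) free_lie \<Rightarrow> ('x, 'p) free_lie) monoid" where
  "lie_End X = \<lparr>carrier = {f \<in> free_lie_on X \<rightarrow>\<^sub>E free_lie_on X.
                    lie_hom_on (free_lie_on X) lscale lbracket lscale lbracket f},
     monoid.mult = compose (free_lie_on X),
     one = (\<lambda>u\<in>free_lie_on X. u)\<rparr>"

lemma monoid_lie_End:
  "monoid (lie_End X :: (('a, 'b::field) free_lie \<Rightarrow> ('a, 'b) free_lie) monoid)"
proof
  fix f g h :: "('a, 'b) free_lie \<Rightarrow> ('a, 'b) free_lie"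
  assume f: "f \<in> carrier (lie_End X)" and g: "g \<in> carrier (lie_End X)"
  show "f \<otimes>\<^bsub>lie_End X\<^esub> g \<in> carrier (lie_End X)"
    using f g
    by (auto simp: lie_End_def lie_hom_on_def compose_def PiE_iff Pi_iff
        intro: free_lie_on.intros)
  show "\<one>\<^bsub>lie_End X\<^esub> \<otimes>\<^bsub>lie_End X\<^esub> f = f"
    using f by (auto simp: lie_End_def compose_def PiE_iff extensional_def fun_eq_iff)
  show "f \<otimes>\<^bsub>lie_End X\<^esub> \<one>\<^bsub>lie_End X\<^esub> = f"
    using f by (auto simp: lie_End_def compose_def PiE_iff extensional_def fun_eq_iff)
  assume "h \<in> carrier (lie_End X)"
  then show "f \<otimes>\<^bsub>lie_End X\<^esub> g \<otimes>\<^bsub>lie_End X\<^esub> h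
      = f \<otimes>\<^bsub>lie_End X\<^esub> (g \<otimes>\<^bsub>lie_End X\<^esub> h)"
    by (auto simp: lie_End_def compose_def PiE_iff fun_eq_iff)
next
  show "\<one>\<^bsub>lie_End X\<^esub> \<in> carrier (lie_End X)"
    by (auto simp: lie_End_def lie_hom_on_def intro: free_lie_on.intros)
qed

definition lie_Aut :: "'x set \<Rightarrow> (('x, 'p::field) free_lie \<Rightarrow> ('x, 'p) free_lie) set" where
  "lie_Aut X = Units (lie_End X)"

definition lie_Aut_lin :: "'x set \<Rightarrow> (('x, 'p::field) free_lie \<Rightarrow> ('x, 'p) free_lie) set" where
  "lie_Aut_lin X = {g \<in> lie_Aut X. \<forall>x\<in>X. g (lgen x) \<in> free_lie.span (lgen ` X)}"

definition linearly_stable ::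
  "'x set \<Rightarrow> ((('x, 'p::field) free_lie \<Rightarrow> ('x, 'p) free_lie)
    \<Rightarrow> (('x, 'p) free_lie \<Rightarrow> ('x, 'p) free_lie)) \<Rightarrow> bool" where
  "linearly_stable X \<xi> \<longleftrightarrow> (\<forall>g\<in>lie_Aut_lin X. \<xi> g = g)"

end

theory Submission
  imports Defs "HOL-Computational_Algebra.Polynomial"
begin

text \<open>
  Fix \<open>x\<^sub>0 \<in> X\<close> and, for \<open>u \<in> F(X)\<close>, let \<open>pt u\<close> be the endomorphism \<open>x\<^sub>0 \<mapsto> u\<close>, \<open>x \<mapsto> 0\<close> for the
  other generators. A linearly stable \<open>\<xi>\<close> preserves the relations between the idempotent
  \<open>e = pt x\<^sub>0\<close> and the linear automorphisms, and therefore fixes \<open>e\<close> (\<open>xi_pt_gen\<close>). Indeed,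
  diagonal automorphisms \<open>g\<close> with \<open>e g = e\<close> force \<open>\<xi>(e)\<close> to kill the other generators. Since \<open>e\<close>
  commutes with all dilations \<open>x \<mapsto> c x\<close>, so does \<open>\<xi>(e)\<close>, and \<open>\<xi>(e)(x\<^sub>0)\<close> has degree \<open>1\<close>: over an
  infinite field the homogeneous components of \<open>F(X)\<close> are the eigenspaces of the dilations
  (\<open>eigenvector_imp_lie_homog\<close>). Diagonal automorphisms with \<open>g e = e\<close> then leave only multiples
  of \<open>x\<^sub>0\<close>, and idempotency and injectivity of \<open>\<xi>\<close> exclude all of them except \<open>x\<^sub>0\<close> itself.

  As \<open>{pt u | u \<in> F(X)} = {\<phi> | \<phi> e = \<phi>}\<close>, there is a bijection \<open>s\<close> of \<open>F(X)\<close> with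
  \<open>\<xi>(pt u) = pt (s u)\<close>, and \<open>\<phi> (pt u) = pt (\<phi> u)\<close> yields \<open>s (\<phi> u) = \<xi>(\<phi>) (s u)\<close>
  (\<open>s_intertwines\<close>). Thus \<open>\<xi>\<close> is conjugation by \<open>s\<close>, and what remains is to correct \<open>s\<close> to a Lie
  automorphism. It commutes with linear automorphisms and fixes \<open>x\<^sub>0\<close>, hence it fixes all
  generators, their multiples \<open>c x\<^sub>0\<close> and the sums \<open>x\<^sub>0 + y\<close>. Substituting arbitrary elements for
  the generators, that is, applying \<open>s_intertwines\<close>, shows that \<open>s\<close> is linear. The element
  \<open>s [x\<^sub>0, y]\<close> is homogeneous of degree \<open>2\<close> and only involves \<open>x\<^sub>0\<close> and \<open>y\<close>, so it equals
  \<open>c [x\<^sub>0, y]\<close>, and by substitution \<open>s [u, v] = c [s u, s v]\<close> for all \<open>u\<close> and \<open>v\<close>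
  (\<open>s_bracket\<close>). The scalar \<open>c\<close> can be taken nonzero, because \<open>s\<close> is injective. Then \<open>f = c s\<close> is
  a Lie algebra automorphism, and it induces the same conjugation as \<open>s\<close>, since endomorphisms
  commute with scalars. If \<open>x\<^sub>0\<close> is the only generator, then \<open>F(X)\<close> consists of the multiples of
  \<open>x\<^sub>0\<close>, and \<open>s\<close> is the identity.
\<close>

section \<open>Endomorphisms as assignments of the generators\<close>

lemma lie_EndD:
  assumes "\<phi> \<in> carrier (lie_End X)"
  shows lie_End_closed: "u \<in> free_lie_on X \<Longrightarrow> \<phi> u \<in> free_lie_on X"
    and lie_End_add: "u \<in> free_lie_on X \<Longrightarrow> v \<in> free_lie_on X \<Longrightarrow> \<phi> (u + v) = \<phi> u + \<phi> v"
    and lie_End_scale: "u \<in> free_lie_on X \<Longrightarrow> \<phi> (lscale c u) = lscale c (\<phi> u)"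
    and lie_End_bracket: "u \<in> free_lie_on X \<Longrightarrow> v \<in> free_lie_on X \<Longrightarrow>
          \<phi> (lbracket u v) = lbracket (\<phi> u) (\<phi> v)"
    and lie_End_undefined: "u \<notin> free_lie_on X \<Longrightarrow> \<phi> u = undefined"
  using assms unfolding lie_End_def lie_hom_on_def by auto

lemma lie_EndI:
  assumes "\<And>u. u \<in> free_lie_on X \<Longrightarrow> f u \<in> free_lie_on X"
    and "\<And>u v. u \<in> free_lie_on X \<Longrightarrow> v \<in> free_lie_on X \<Longrightarrow> f (u + v) = f u + f v"
    and "\<And>c u. u \<in> free_lie_on X \<Longrightarrow> f (lscale c u) = lscale c (f u)"
    and "\<And>u v. u \<in> free_lie_on X \<Longrightarrow> v \<in> free_lie_on X \<Longrightarrow>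
          f (lbracket u v) = lbracket (f u) (f v)"
  shows "restrict f (free_lie_on X) \<in> carrier (lie_End X)"
  using assms unfolding lie_End_def lie_hom_on_def
  by (auto intro: free_lie_on.intros)

lemma lie_End_zero:
  assumes "\<phi> \<in> carrier (lie_End X)"
  shows "\<phi> 0 = 0"
  using lie_End_scale[OF assms free_lie_on.zero, of 0] by simp

lemma lie_End_mult_apply:
  "u \<in> free_lie_on X \<Longrightarrow> (\<phi> \<otimes>\<^bsub>lie_End X\<^esub> \<psi>) u = \<phi> (\<psi> u)"
  by (simp add: lie_End_def compose_def)

lemma lie_End_one_apply: "u \<in> free_lie_on X \<Longrightarrow> \<one>\<^bsub>lie_End X\<^esub> u = u"
  by (simp add: lie_End_def)

lemma lie_End_mult_closed:
  assumes "\<phi> \<in> carrier (lie_End X)" "\<psi> \<in> carrier (lie_End X)"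
  shows "\<phi> \<otimes>\<^bsub>lie_End X\<^esub> \<psi> \<in> carrier (lie_End X)"
  using monoid.m_closed[OF monoid_lie_End assms] .

lemma lie_End_eqI:
  assumes "\<phi> \<in> carrier (lie_End X)" "\<psi> \<in> carrier (lie_End X)"
    and "\<And>u. u \<in> free_lie_on X \<Longrightarrow> \<phi> u = \<psi> u"
  shows "\<phi> = \<psi>"
proof
  show "\<phi> u = \<psi> u" for u
    by (cases "u \<in> free_lie_on X")
      (simp_all add: assms(3) lie_End_undefined[OF assms(1)] lie_End_undefined[OF assms(2)])
qed

lemma lie_End_eqI_gen:
  assumes "\<phi> \<in> carrier (lie_End X)" "\<psi> \<in> carrier (lie_End X)"
    and "\<And>x. x \<in> X \<Longrightarrow> \<phi> (lgen x) = \<psi> (lgen x)"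
  shows "\<phi> = \<psi>"
proof (rule lie_End_eqI[OF assms(1,2)])
  fix u :: "('a, 'b) free_lie"
  assume "u \<in> free_lie_on X"
  then show "\<phi> u = \<psi> u"
  proof induction
    case zero
    show ?case
      by (simp add: lie_End_zero[OF assms(1)] lie_End_zero[OF assms(2)])
  qed (simp_all add: assms(3) lie_End_add[OF assms(1)] lie_End_add[OF assms(2)]
      lie_End_scale[OF assms(1)] lie_End_scale[OF assms(2)]
      lie_End_bracket[OF assms(1)] lie_End_bracket[OF assms(2)])
qed

lemma lie_End_ex:
  fixes g :: "'x \<Rightarrow> ('x, 'p::field) free_lie"
  assumes g: "\<And>x. x \<in> X \<Longrightarrow> g x \<in> free_lie_on X"
  shows "\<exists>\<phi>. \<phi> \<in> carrier (lie_End X) \<and> (\<forall>x\<in>X. \<phi> (lgen x) = g x)"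
proof -
  obtain h where h: "lie_hom_on (free_lie_on X) lscale lbracket lscale lbracket h"
    and hg: "\<And>x. x \<in> X \<Longrightarrow> h (lgen x) = g x"
    using free_lie.free_lie_on_universal[of X g] by blast
  note h = h[unfolded lie_hom_on_def]
  have "h (lscale 0 0) = lscale 0 (h 0)"
    using h free_lie_on.zero by blast
  then have h0: "h 0 = 0"
    by simp
  have "h u \<in> free_lie_on X" if "u \<in> free_lie_on X" for u
    using that by induction (use h h0 hg g in \<open>auto intro: free_lie_on.intros\<close>)
  then have "restrict h (free_lie_on X) \<in> carrier (lie_End X)"
    using h by (intro lie_EndI) auto
  then show ?thesis
    using hg by (auto intro!: exI[of _ "restrict h (free_lie_on X)"] free_lie_on.gen)
qed

text \<open>The endomorphism of \<open>F(X)\<close> that sends each \<open>x \<in> X\<close> to \<open>g x\<close>. Assignments are functions of the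
  labels \<open>x\<close>, so injectivity of \<open>lgen\<close> plays no role. If some \<open>g x\<close> with \<open>x \<in> X\<close> lies outside
  \<open>F(X)\<close>, no such endomorphism exists and the value is unspecified.\<close>

definition lie_lift ::
  "'x set \<Rightarrow> ('x \<Rightarrow> ('x, 'p::field) free_lie) \<Rightarrow> ('x, 'p) free_lie \<Rightarrow> ('x, 'p) free_lie"
  where "lie_lift X g =
    (SOME \<phi>. \<phi> \<in> carrier (lie_End X) \<and> (\<forall>x\<in>X. \<phi> (lgen x) = g x))"

lemma
  assumes "\<And>x. x \<in> X \<Longrightarrow> g x \<in> free_lie_on X"
  shows lie_lift_closed: "lie_lift X g \<in> carrier (lie_End X)"
    and lie_lift_gen: "x \<in> X \<Longrightarrow> lie_lift X g (lgen x) = g x"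
  using someI_ex[OF lie_End_ex[of X g, OF assms]] unfolding lie_lift_def by blast+

lemma span_gen_subset: "free_lie.span (lgen ` X) \<subseteq> free_lie_on X"
  by (rule free_lie.span_minimal)
    (auto simp: free_lie.subspace_def intro: free_lie_on.intros)

lemma lie_lift_linear_Aut:
  fixes g g' :: "'x \<Rightarrow> ('x, 'p::field) free_lie"
  assumes g: "\<And>x. x \<in> X \<Longrightarrow> g x \<in> free_lie.span (lgen ` X)"
    and g': "\<And>x. x \<in> X \<Longrightarrow> g' x \<in> free_lie.span (lgen ` X)"
    and inv: "\<And>x. x \<in> X \<Longrightarrow> lie_lift X g (g' x) = lgen x"
    and inv': "\<And>x. x \<in> X \<Longrightarrow> lie_lift X g' (g x) = lgen x"
  shows "lie_lift X g \<in> lie_Aut_lin X"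
proof -
  have F: "\<And>x. x \<in> X \<Longrightarrow> g x \<in> free_lie_on X" "\<And>x. x \<in> X \<Longrightarrow> g' x \<in> free_lie_on X"
    using g g' span_gen_subset by blast+
  have c: "lie_lift X g \<in> carrier (lie_End X)" "lie_lift X g' \<in> carrier (lie_End X)"
    using F by (auto intro: lie_lift_closed)
  have one: "\<one>\<^bsub>lie_End X\<^esub> \<in> carrier (lie_End X :: (('x, 'p) free_lie \<Rightarrow> _) monoid)"
    by (rule monoid.one_closed[OF monoid_lie_End])
  have "lie_lift X g \<otimes>\<^bsub>lie_End X\<^esub> lie_lift X g' = \<one>\<^bsub>lie_End X\<^esub>"
    by (rule lie_End_eqI_gen[OF lie_End_mult_closed[OF c] one])
      (simp add: lie_End_mult_apply lie_End_one_apply free_lie_on.gen lie_lift_gen F(2) inv)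
  moreover have "lie_lift X g' \<otimes>\<^bsub>lie_End X\<^esub> lie_lift X g = \<one>\<^bsub>lie_End X\<^esub>"
    by (rule lie_End_eqI_gen[OF lie_End_mult_closed[OF c(2,1)] one])
      (simp add: lie_End_mult_apply lie_End_one_apply free_lie_on.gen lie_lift_gen F(1) inv')
  ultimately show ?thesis
    using c g by (auto simp: lie_Aut_lin_def lie_Aut_def Units_def lie_lift_gen F)
qed

lemma bij_in_lie_Aut:
  assumes f: "f \<in> carrier (lie_End X)" and bij: "bij_betw f (free_lie_on X) (free_lie_on X)"
  shows "f \<in> lie_Aut X"
proof -
  define h where "h = restrict (inv_into (free_lie_on X) f) (free_lie_on X)"
  have hF: "h u \<in> free_lie_on X" and fh: "f (h u) = u" if "u \<in> free_lie_on X" for u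
    using that bij unfolding h_def
    by (auto simp: bij_betw_inv_into_right intro: bij_betwE[OF bij_betw_inv_into, rule_format])
  have hf: "h (f u) = u" if "u \<in> free_lie_on X" for u
    using that bij lie_End_closed[OF f that] unfolding h_def by (simp add: bij_betw_inv_into_left)
  have h_eq: "h v = u" if "u \<in> free_lie_on X" "f u = v" for u v
    using hf that by auto
  have "restrict h (free_lie_on X) \<in> carrier (lie_End X)"
    by (intro lie_EndI h_eq)
      (simp_all add: hF fh free_lie_on.intros lie_End_add[OF f] lie_End_scale[OF f]
        lie_End_bracket[OF f])
  moreover have "restrict h (free_lie_on X) = h"
    by (auto simp: h_def)
  ultimately have h: "h \<in> carrier (lie_End X)"
    by simp
  have "f \<otimes>\<^bsub>lie_End X\<^esub> h = \<one>\<^bsub>lie_End X\<^esub>" "h \<otimes>\<^bsub>lie_End X\<^esub> f = \<one>\<^bsub>lie_End X\<^esub>"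
    by (auto intro!: lie_End_eqI lie_End_mult_closed f h monoid.one_closed[OF monoid_lie_End]
        simp: lie_End_mult_apply lie_End_one_apply fh hf)
  then show ?thesis
    using f h by (auto simp: lie_Aut_def Units_def)
qed


section \<open>The grading by total degree\<close>

text \<open>The component of degree \<open>k\<close> of \<open>F(X)\<close>, spanned by the Lie monomials of degree \<open>k\<close>.\<close>

inductive lie_homog :: "'x set \<Rightarrow> nat \<Rightarrow> ('x, 'p::field) free_lie \<Rightarrow> bool" for X :: "'x set" where
  gen: "x \<in> X \<Longrightarrow> lie_homog X 1 (lgen x)"
| zero: "lie_homog X k 0"
| add: "lie_homog X k u \<Longrightarrow> lie_homog X k v \<Longrightarrow> lie_homog X k (u + v)"
| scale: "lie_homog X k u \<Longrightarrow> lie_homog X k (lscale c u)"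
| bracket: "lie_homog X j u \<Longrightarrow> lie_homog X k v \<Longrightarrow> lie_homog X (j + k) (lbracket u v)"

lemma lie_homog_in_free_lie_on: "lie_homog X k u \<Longrightarrow> u \<in> free_lie_on X"
  by (induction rule: lie_homog.induct) (auto intro: free_lie_on.intros)

lemma lbracket_zero [simp]: "lbracket 0 u = 0" "lbracket u 0 = 0"
  using free_lie.bracket_scale_left[of 0 0 u] free_lie.bracket_scale_right[of u 0 0] by simp_all

lemma lbracket_antisym: "lbracket u v = - lbracket v u"
proof -
  have "lbracket (u + v) (u + v) = lbracket u v + lbracket v u"
    unfolding free_lie.bracket_add_left free_lie.bracket_add_right
    by (simp add: free_lie.bracket_self)
  then show ?thesis
    by (simp add: free_lie.bracket_self eq_neg_iff_add_eq_0)
qed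

lemma lbracket_span_span:
  assumes "u \<in> free_lie.span A" "v \<in> free_lie.span B"
  shows "lbracket u v \<in> free_lie.span {lbracket a b |a b. a \<in> A \<and> b \<in> B}" (is "_ \<in> ?S")
  using assms(1)
proof (induction rule: free_lie.span_induct_alt)
  case base
  show ?case by (simp add: free_lie.span_zero)
next
  case (step c a y)
  have "lbracket a v \<in> ?S"
    using assms(2)
  proof (induction rule: free_lie.span_induct_alt)
    case base
    show ?case by (simp add: free_lie.span_zero)
  next
    case (step c b y)
    then show ?case
      using \<open>a \<in> A\<close>
      by (auto simp: free_lie.bracket_add_right free_lie.bracket_scale_right
          intro!: free_lie.span_add free_lie.span_scale intro: free_lie.span_base)
  qed
  then show ?case
    using step
    by (auto simp: free_lie.bracket_add_left free_lie.bracket_scale_left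
        intro!: free_lie.span_add free_lie.span_scale)
qed

text \<open>Only degrees \<open>0\<close>, \<open>1\<close> and \<open>2\<close> matter below; degree \<open>0\<close> is needed for the induction, where it
  shows that brackets of degree \<open>1\<close> vanish.\<close>

lemma lie_homog_low_degree:
  "lie_homog X k u \<Longrightarrow>
    (k = 0 \<longrightarrow> u = 0) \<and> (k = 1 \<longrightarrow> u \<in> free_lie.span (lgen ` X)) \<and>
    (k = 2 \<longrightarrow> u \<in> free_lie.span {lbracket a b |a b. a \<in> lgen ` X \<and> b \<in> lgen ` X})"
proof (induction rule: lie_homog.induct)
  case (bracket j u k v)
  consider "j = 0" | "k = 0" | "j = 1" "k = 1" | "j + k > 2"
    by linarith
  then show ?case
    using bracket lbracket_span_span[of u "lgen ` X" v "lgen ` X"]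
    by cases (auto simp: free_lie.span_zero)
qed (auto intro: free_lie.span_base free_lie.span_zero free_lie.span_add free_lie.span_scale)

text \<open>Every element is a finite sum of homogeneous ones. The zero tail of \<open>w\<close> allows two
  decompositions to be brought to a common length.\<close>

lemma free_lie_on_decompose:
  assumes "u \<in> free_lie_on X"
  shows "\<exists>N w. (\<forall>k. lie_homog X k (w k)) \<and> (\<forall>k\<ge>N. w k = 0) \<and> u = (\<Sum>k<N. w k)"
    (is "?D u")
proof -
  have homog: "?D u" if "lie_homog X k u" for k and u :: "('a, 'b) free_lie"
    using that by (intro exI[of _ "Suc k"] exI[of _ "\<lambda>i. if i = k then u else 0"])
      (auto intro: lie_homog.zero)
  have zero: "?D 0"
    by (rule homog[OF lie_homog.zero[of X 0]])
  have add: "?D (u + v)" if uv: "?D u" "?D v" for u v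
  proof -
    obtain N w where w: "\<And>k. lie_homog X k (w k)" "\<And>k. k \<ge> N \<Longrightarrow> w k = 0" "u = (\<Sum>k<N. w k)"
      using uv(1) by blast
    obtain M w' where w': "\<And>k. lie_homog X k (w' k)" "\<And>k. k \<ge> M \<Longrightarrow> w' k = 0" "v = (\<Sum>k<M. w' k)"
      using uv(2) by blast
    have "u = (\<Sum>k<max N M. w k)" "v = (\<Sum>k<max N M. w' k)"
      unfolding w(3) w'(3) by (intro sum.mono_neutral_left; auto simp: w(2) w'(2))+
    then show ?thesis
      by (intro exI[of _ "max N M"] exI[of _ "\<lambda>k. w k + w' k"])
        (auto simp: sum.distrib w w' intro: lie_homog.add)
  qed
  have sum: "?D (\<Sum>i\<in>I. f i)" if "\<And>i. i \<in> I \<Longrightarrow> ?D (f i)" for I :: "nat set" and f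
    using that
  proof (induction I rule: infinite_finite_induct)
    case (insert i I)
    have "?D (f i + sum f I)"
      by (intro add insert) auto
    then show ?case
      using insert.hyps by simp
  qed (use zero in simp_all)
  have sum_left: "lbracket (\<Sum>i\<in>I. f i) v = (\<Sum>i\<in>I. lbracket (f i) v)"
    for I :: "nat set" and f and v :: "('a, 'b) free_lie"
    by (induction I rule: infinite_finite_induct) (simp_all add: free_lie.bracket_add_left)
  have sum_right: "lbracket v (\<Sum>i\<in>I. f i) = (\<Sum>i\<in>I. lbracket v (f i))"
    for I :: "nat set" and f and v :: "('a, 'b) free_lie"
    by (induction I rule: infinite_finite_induct) (simp_all add: free_lie.bracket_add_right)
  show ?thesis
    using assms
  proof induction
    case (gen x)
    then show ?case
      by (intro homog[OF lie_homog.gen])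
  next
    case (scale u c)
    then obtain N w where w: "\<And>k. lie_homog X k (w k)" and u: "u = (\<Sum>k<N. w k)"
      by blast
    show ?case
      unfolding u free_lie.scale_sum_right by (rule sum, rule homog, rule lie_homog.scale, rule w)
  next
    case (bracket u v)
    then obtain N w M w' where w: "\<And>k. lie_homog X k (w k)" and u: "u = (\<Sum>k<N. w k)"
      and w': "\<And>k. lie_homog X k (w' k)" and v: "v = (\<Sum>k<M. w' k)"
      by blast
    show ?case
      unfolding u v sum_left sum_right
      by (rule sum, rule sum, rule homog, rule lie_homog.bracket, rule w, rule w')
  qed (rule zero, rule add)
qed

lemma lie_homog_dilate:
  assumes "\<phi> \<in> carrier (lie_End X)" and "\<And>x. x \<in> X \<Longrightarrow> \<phi> (lgen x) = lscale c (lgen x)"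
  shows "lie_homog X k u \<Longrightarrow> \<phi> u = lscale (c ^ k) u"
proof (induction rule: lie_homog.induct)
  case (zero k)
  show ?case using lie_End_zero[OF assms(1)] by simp
qed (simp_all add: assms(2) lie_End_add[OF assms(1)] lie_End_scale[OF assms(1)]
    lie_End_bracket[OF assms(1)] lie_homog_in_free_lie_on free_lie.scale_right_distrib
    free_lie.bracket_scale_left free_lie.bracket_scale_right power_add mult.commute)

text \<open>A polynomial function with coefficients in a vector space that has infinitely many zeros
  has zero coefficients: each coordinate in a basis is an ordinary polynomial.\<close>

lemma (in vector_space) poly_coeffs_zero:
  assumes "infinite A" and zero: "\<And>c. c \<in> A \<Longrightarrow> (\<Sum>k<N. scale (c ^ k) (w k)) = 0"
    and "k < N"
  shows "w k = 0"
proof -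
  define B where "B = extend_basis {}"
  have ind: "independent B" and sp: "v \<in> span B" for v
    using independent_extend_basis[of "{}"] span_extend_basis[of "{}"] independent_empty
    unfolding B_def by auto
  have "representation B (w k) b = 0" for b
  proof -
    define p where "p = (\<Sum>k<N. monom (representation B (w k) b) k)"
    have "poly p c = representation B (\<Sum>k<N. scale (c ^ k) (w k)) b" for c
      unfolding p_def
      by (simp add: poly_sum poly_monom representation_sum[OF ind sp] representation_scale[OF ind sp]
          mult.commute)
    then have "A \<subseteq> {c. poly p c = 0}"
      by (auto simp: zero representation_zero)
    then have "p = 0"
      using \<open>infinite A\<close> poly_roots_finite finite_subset by blast
    moreover have "coeff p k = representation B (w k) b"
      using \<open>k < N\<close> by (simp add: p_def coeff_sum)
    ultimately show ?thesis
      by simp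
  qed
  then show ?thesis
    using sum_nonzero_representation_eq[OF ind sp, of "w k"] by simp
qed

text \<open>Over an infinite field, the component of degree \<open>j\<close> is cut out by the dilations
  \<open>x \<mapsto> c x\<close>: if \<open>u\<close> has components \<open>w k\<close>, then \<open>(\<Sum>k. c ^ k w k) - c ^ j u = 0\<close> is a
  polynomial identity in \<open>c\<close>, whose coefficient \<open>w j - u\<close> vanishes.\<close>

lemma eigenvector_imp_lie_homog:
  fixes u :: "('x, 'p::field) free_lie"
  assumes inf: "infinite (UNIV :: 'p set)" and u: "u \<in> free_lie_on X"
    and eig: "\<And>c \<phi>. c \<noteq> 0 \<Longrightarrow> \<phi> \<in> carrier (lie_End X) \<Longrightarrow>
      (\<And>x. x \<in> X \<Longrightarrow> \<phi> (lgen x) = lscale c (lgen x)) \<Longrightarrow> \<phi> u = lscale (c ^ j) u"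
  shows "lie_homog X j u"
proof -
  obtain N w where w: "\<And>k. lie_homog X k (w k)" and w0: "\<And>k. k \<ge> N \<Longrightarrow> w k = 0"
    and u_eq: "u = (\<Sum>k<N. w k)"
    using free_lie_on_decompose[OF u] by blast
  \<comment> \<open>The summation range is enlarged so that it contains \<open>j\<close>.\<close>
  define M where "M = max N (Suc j)"
  have jM: "j < M"
    by (simp add: M_def less_max_iff_disj)
  define v where "v k = w k - (if k = j then u else 0)" for k
  have u_eq': "u = (\<Sum>k<M. w k)"
    unfolding u_eq by (rule sum.mono_neutral_left) (auto simp: M_def w0)
  have "(\<Sum>k<M. lscale (c ^ k) (v k)) = 0" if "c \<in> - {0}" for c
  proof -
    define \<phi> where "\<phi> = lie_lift X (\<lambda>x. lscale c (lgen x))"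
    have \<phi>: "\<phi> \<in> carrier (lie_End X)" and \<phi>g: "\<And>x. x \<in> X \<Longrightarrow> \<phi> (lgen x) = lscale c (lgen x)"
      unfolding \<phi>_def by (auto intro!: lie_lift_closed lie_lift_gen free_lie_on.intros)
    have \<phi>_sum: "\<phi> (\<Sum>k<n. w k) = (\<Sum>k<n. lscale (c ^ k) (w k)) \<and> (\<Sum>k<n. w k) \<in> free_lie_on X"
      for n
      by (induction n)
        (auto simp: lie_End_zero[OF \<phi>] lie_End_add[OF \<phi>] lie_homog_in_free_lie_on[OF w]
          lie_homog_dilate[OF \<phi> \<phi>g w] intro!: free_lie_on.intros lie_homog_in_free_lie_on[OF w])
    have "(\<Sum>k<M. lscale (c ^ k) (v k)) =
        (\<Sum>k<M. lscale (c ^ k) (w k)) - (\<Sum>k<M. if k = j then lscale (c ^ j) u else 0)"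
      unfolding v_def sum_subtractf[symmetric]
      by (intro sum.cong) (auto simp: free_lie.scale_right_diff_distrib)
    also have "\<dots> = \<phi> u - lscale (c ^ j) u"
      using conjunct1[OF \<phi>_sum[of M]] unfolding u_eq'[symmetric] by (simp add: jM)
    also have "\<dots> = 0"
      using eig[OF _ \<phi> \<phi>g] that by simp
    finally show ?thesis .
  qed
  moreover have "infinite (- {0 :: 'p})"
    using inf by (simp add: Compl_eq_Diff_UNIV)
  ultimately have "v j = 0"
    using jM free_lie.poly_coeffs_zero[of "- {0}" v M j] by blast
  then show ?thesis
    using w[of j] by (simp add: v_def)
qed

lemma free_lie_on_singleton:
  assumes "X \<subseteq> {x}" "u \<in> free_lie_on X"
  shows "\<exists>c. u = lscale c (lgen x)"
  using assms(2)
proof induction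
  case (gen y)
  then show ?case using assms(1) by (intro exI[of _ 1]) auto
next
  case zero
  show ?case by (intro exI[of _ 0]) simp
next
  case (add u v)
  then show ?case by (metis free_lie.scale_left_distrib)
next
  case (scale u c)
  then show ?case by auto
next
  case (bracket u v)
  then show ?case
    by (intro exI[of _ 0])
      (auto simp: free_lie.bracket_scale_left free_lie.bracket_scale_right free_lie.bracket_self)
qed

section \<open>Linearly stable automorphisms of the endomorphism semigroup\<close>

lemma lie_Aut_lin_closed: "g \<in> lie_Aut_lin X \<Longrightarrow> g \<in> carrier (lie_End X)"
  by (auto simp: lie_Aut_lin_def lie_Aut_def Units_def)

lemma diagonal_lie_Aut_lin:
  fixes a :: "'x \<Rightarrow> 'p::field"
  assumes "\<And>x. x \<in> X \<Longrightarrow> a x \<noteq> 0"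
  shows "lie_lift X (\<lambda>x. lscale (a x) (lgen x)) \<in> lie_Aut_lin X"
proof (rule lie_lift_linear_Aut)
  have F: "\<And>x. x \<in> X \<Longrightarrow> lscale (b x) (lgen x) \<in> free_lie_on X" for b :: "'x \<Rightarrow> 'p"
    by (intro free_lie_on.scale free_lie_on.gen)
  have "lie_lift X (\<lambda>x. lscale (b x) (lgen x)) (lscale (inverse (b x)) (lgen x)) = lgen x"
    if "x \<in> X" "b x \<noteq> 0" for b :: "'x \<Rightarrow> 'p" and x
    using that F by (simp add: lie_End_scale[OF lie_lift_closed] lie_lift_gen free_lie_on.gen)
  from this[of _ a] this[of _ "\<lambda>x. inverse (a x)"]
  show "lie_lift X (\<lambda>x. lscale (a x) (lgen x)) (lscale (inverse (a x)) (lgen x)) = lgen x"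
    and "lie_lift X (\<lambda>x. lscale (inverse (a x)) (lgen x)) (lscale (a x) (lgen x)) = lgen x"
    if "x \<in> X" for x
    using that assms by auto
qed (auto intro: free_lie.span_scale free_lie.span_base)

lemma transposition_lie_Aut_lin:
  assumes "x \<in> X" "y \<in> X"
  shows "lie_lift X (\<lambda>z. lgen (if z = x then y else if z = y then x else z)) \<in> lie_Aut_lin X"
  by (rule lie_lift_linear_Aut[where g' = "\<lambda>z. lgen (if z = x then y else if z = y then x else z)"])
    (use assms in \<open>auto simp: lie_lift_gen free_lie_on.gen intro: free_lie.span_base\<close>)

lemma transvection_lie_Aut_lin:
  fixes x y :: 'x
  assumes "x \<in> X" "y \<in> X" "x \<noteq> y"
  shows "lie_lift X (\<lambda>z. if z = x then lgen x + lgen y else lgen z :: ('x, 'p::field) free_lie)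
    \<in> lie_Aut_lin X"
proof -
  define h where "h c z = (if z = x then lgen x + lscale c (lgen y) else lgen z :: ('x, 'p) free_lie)"
    for c z
  have span: "h c z \<in> free_lie.span (lgen ` X)" if "z \<in> X" for c z
    using that assms
    by (auto simp: h_def intro: free_lie.span_base free_lie.span_add free_lie.span_scale)
  then have F: "\<And>z. z \<in> X \<Longrightarrow> h c z \<in> free_lie_on X" for c
    using span_gen_subset by blast
  have g: "lie_lift X (h c) \<in> carrier (lie_End X)" for c
    by (rule lie_lift_closed[OF F])
  have g_gen: "lie_lift X (h c) (lgen z) = h c z" if "z \<in> X" for c z
    by (simp add: lie_lift_gen F that)
  have inv: "lie_lift X (h c) (h (- c) z) = lgen z" if "z \<in> X" for z c
  proof (cases "z = x")
    case True
    have "lie_lift X (h c) (h (- c) x) =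
        lgen x + (lscale c (lgen y) + lscale (- c) (lgen y))"
      using assms
      by (simp add: h_def[of "- c"] lie_End_add[OF g] lie_End_scale[OF g] free_lie_on.intros g_gen
          del: free_lie.scale_minus_left) (simp add: h_def)
    then show ?thesis
      using True by simp
  qed (use that in \<open>simp add: h_def[of "- c"] g_gen, simp add: h_def\<close>)
  have "lie_lift X (h 1) \<in> lie_Aut_lin X"
    using inv[of _ 1] inv[of _ "- 1"] by (intro lie_lift_linear_Aut[of X "h 1" "h (- 1)"] span) auto
  moreover have "h 1 = (\<lambda>z. if z = x then lgen x + lgen y else lgen z)"
    by (auto simp: h_def)
  ultimately show ?thesis
    by simp
qed

text \<open>A linearly stable automorphism \<open>\<xi>\<close> of the semigroup \<open>End(F(X))\<close> over an infinite field, with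
  a chosen generator \<open>x0\<close>.\<close>

locale linearly_stable_iso =
  fixes X :: "'x set"
    and \<xi> :: "(('x, 'p::field) free_lie \<Rightarrow> ('x, 'p) free_lie)
                \<Rightarrow> (('x, 'p) free_lie \<Rightarrow> ('x, 'p) free_lie)"
    and x0 :: 'x
  assumes inf: "infinite (UNIV :: 'p set)"
    and iso: "\<xi> \<in> iso (lie_End X) (lie_End X)"
    and stable: "linearly_stable X \<xi>"
    and x0: "x0 \<in> X"
begin

abbreviation "F \<equiv> free_lie_on X :: ('x, 'p) free_lie set"
abbreviation "E \<equiv> carrier (lie_End X) :: (('x, 'p) free_lie \<Rightarrow> ('x, 'p) free_lie) set"
abbreviation gn :: "'x \<Rightarrow> ('x, 'p) free_lie" where "gn \<equiv> lgen"

lemma xi_closed: "\<phi> \<in> E \<Longrightarrow> \<xi> \<phi> \<in> E"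
  using iso by (auto simp: iso_def hom_def)

lemma xi_mult: "\<phi> \<in> E \<Longrightarrow> \<psi> \<in> E \<Longrightarrow> \<xi> (\<phi> \<otimes>\<^bsub>lie_End X\<^esub> \<psi>) = \<xi> \<phi> \<otimes>\<^bsub>lie_End X\<^esub> \<xi> \<psi>"
  using iso by (auto simp: iso_def hom_def)

lemma xi_inj: "\<phi> \<in> E \<Longrightarrow> \<psi> \<in> E \<Longrightarrow> \<xi> \<phi> = \<xi> \<psi> \<Longrightarrow> \<phi> = \<psi>"
  using iso by (auto simp: iso_def bij_betw_def inj_on_def)

lemma xi_surj:
  assumes "\<psi> \<in> E"
  obtains \<phi> where "\<phi> \<in> E" "\<xi> \<phi> = \<psi>"
proof -
  have "\<xi> ` E = E"
    using iso by (auto simp: iso_def bij_betw_def)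
  then show ?thesis
    using assms that by (metis imageE)
qed

lemma xi_linear: "g \<in> lie_Aut_lin X \<Longrightarrow> \<xi> g = g"
  using stable by (simp add: linearly_stable_def)

text \<open>The element \<open>u\<close> of \<open>F(X)\<close> is represented in the semigroup by the endomorphism \<open>pt u\<close> that
  sends \<open>x0\<close> to \<open>u\<close> and all other generators to \<open>0\<close>.\<close>

definition pt :: "('x, 'p) free_lie \<Rightarrow> ('x, 'p) free_lie \<Rightarrow> ('x, 'p) free_lie" where
  "pt u = lie_lift X (\<lambda>x. if x = x0 then u else 0)"

lemma pt_closed: "u \<in> F \<Longrightarrow> pt u \<in> E"
  unfolding pt_def by (rule lie_lift_closed) (simp add: free_lie_on.zero)

lemma pt_gen: "u \<in> F \<Longrightarrow> x \<in> X \<Longrightarrow> pt u (gn x) = (if x = x0 then u else 0)"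
  unfolding pt_def by (rule lie_lift_gen) (simp_all add: free_lie_on.zero)

lemma mult_pt:
  assumes "\<phi> \<in> E" "u \<in> F"
  shows "\<phi> \<otimes>\<^bsub>lie_End X\<^esub> pt u = pt (\<phi> u)"
  by (rule lie_End_eqI_gen[OF lie_End_mult_closed[OF assms(1) pt_closed[OF assms(2)]]
        pt_closed[OF lie_End_closed[OF assms]]])
    (simp add: lie_End_mult_apply free_lie_on.gen pt_gen assms(2) lie_End_zero[OF assms(1)]
      lie_End_closed[OF assms])

lemma eq_pt_if:
  assumes "\<phi> \<in> E" "\<phi> \<otimes>\<^bsub>lie_End X\<^esub> pt (gn x0) = \<phi>"
  shows "\<phi> = pt (\<phi> (gn x0))"
  using mult_pt[OF assms(1) free_lie_on.gen[OF x0]] assms(2) by simp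

text \<open>The zero endomorphism is the zero of the semigroup, so every automorphism fixes it.\<close>

lemma xi_pt_zero: "\<xi> (pt 0) = pt 0"
proof -
  have z: "pt 0 \<in> E"
    by (simp add: pt_closed free_lie_on.zero)
  then obtain \<phi> where \<phi>: "\<phi> \<in> E" "\<xi> \<phi> = pt 0"
    by (rule xi_surj)
  have "pt 0 \<otimes>\<^bsub>lie_End X\<^esub> \<phi> = pt 0"
  proof (rule lie_End_eqI[OF lie_End_mult_closed[OF z \<phi>(1)] z])
    have "pt 0 u = 0" if "u \<in> F" for u
      using that
    proof induction
      case zero
      show ?case by (rule lie_End_zero[OF z])
    qed (simp_all add: pt_gen free_lie_on.zero lie_End_add[OF z] lie_End_scale[OF z]
        lie_End_bracket[OF z])
    then show "(pt 0 \<otimes>\<^bsub>lie_End X\<^esub> \<phi>) u = pt 0 u" if "u \<in> F" for u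
      using that by (simp add: lie_End_mult_apply lie_End_closed[OF \<phi>(1)])
  qed
  then have "\<xi> (pt 0) = \<xi> (pt 0) \<otimes>\<^bsub>lie_End X\<^esub> pt 0"
    using xi_mult[OF z \<phi>(1)] \<phi>(2) by simp
  also have "\<dots> = pt 0"
    using mult_pt[OF xi_closed[OF z] free_lie_on.zero] lie_End_zero[OF xi_closed[OF z]] by simp
  finally show ?thesis .
qed

lemma xi_pt_gen: "\<xi> (pt (gn x0)) = pt (gn x0)"
proof -
  define e where "e = pt (gn x0)"
  define e' where "e' = \<xi> e"
  define w where "w = e' (gn x0)"
  have x0F: "gn x0 \<in> F"
    by (rule free_lie_on.gen[OF x0])
  have e: "e \<in> E" and e': "e' \<in> E"
    by (simp_all add: e_def e'_def pt_closed x0F xi_closed)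
  have wF: "w \<in> F"
    unfolding w_def by (rule lie_End_closed[OF e' x0F])
  obtain c :: 'p where c: "c \<noteq> 0" "c \<noteq> 1"
    using ex_new_if_finite[OF inf, of "{0, 1}"] by auto
  \<comment> \<open>From \<open>e g = e\<close> it follows that \<open>e'\<close> kills the generators other than \<open>x0\<close>, and from
    \<open>g e = e\<close> that \<open>w\<close> is fixed by \<open>g\<close>.\<close>
  define g where "g = lie_lift X (\<lambda>x. lscale (if x = x0 then 1 else c) (gn x))"
  have gA: "g \<in> lie_Aut_lin X"
    unfolding g_def by (rule diagonal_lie_Aut_lin) (simp add: c)
  then have g: "g \<in> E" and xi_g: "\<xi> g = g"
    by (simp_all add: lie_Aut_lin_closed xi_linear)
  have g_gen: "g (gn x) = (if x = x0 then gn x0 else lscale c (gn x))" if "x \<in> X" for x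
    using that unfolding g_def by (subst lie_lift_gen) (auto intro: free_lie_on.intros)
  have "e \<otimes>\<^bsub>lie_End X\<^esub> g = e"
    by (rule lie_End_eqI_gen[OF lie_End_mult_closed[OF e g] e])
      (simp add: lie_End_mult_apply free_lie_on.gen g_gen lie_End_scale[OF e], simp add: e_def pt_gen x0F)
  then have e'g: "e' \<otimes>\<^bsub>lie_End X\<^esub> g = e'"
    using xi_mult[OF e g] by (simp add: xi_g e'_def)
  have e'_gen: "e' (gn x) = 0" if "x \<in> X" "x \<noteq> x0" for x
  proof -
    have "e' (gn x) = lscale c (e' (gn x))"
      using fun_cong[OF e'g, of "gn x"] that
      by (simp add: lie_End_mult_apply free_lie_on.gen g_gen lie_End_scale[OF e'])
    then have "lscale (c - 1) (e' (gn x)) = 0"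
      by (simp add: free_lie.scale_left_diff_distrib)
    then show ?thesis
      using c by simp
  qed
  then have e'_pt: "e' = pt w"
    by (intro lie_End_eqI_gen[OF e' pt_closed[OF wF]]) (auto simp: w_def pt_gen wF[unfolded w_def])
  \<comment> \<open>Dilations commute with \<open>e\<close>, hence with \<open>e'\<close>.\<close>
  have "lie_homog X 1 w"
  proof (rule eigenvector_imp_lie_homog[OF inf wF])
    fix d \<phi>
    assume d: "d \<noteq> 0" and \<phi>: "\<phi> \<in> E" and \<phi>g: "\<And>x. x \<in> X \<Longrightarrow> \<phi> (gn x) = lscale d (gn x)"
    have "\<phi> = lie_lift X (\<lambda>x. lscale d (gn x))"
      by (rule lie_End_eqI_gen[OF \<phi>])
        (auto simp: \<phi>g lie_lift_gen free_lie_on.intros intro: lie_lift_closed)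
    then have xi_\<phi>: "\<xi> \<phi> = \<phi>"
      using diagonal_lie_Aut_lin[of X "\<lambda>_. d"] d xi_linear by simp
    have "\<phi> \<otimes>\<^bsub>lie_End X\<^esub> e = e \<otimes>\<^bsub>lie_End X\<^esub> \<phi>"
      by (rule lie_End_eqI_gen[OF lie_End_mult_closed[OF \<phi> e] lie_End_mult_closed[OF e \<phi>]])
        (simp add: lie_End_mult_apply free_lie_on.gen \<phi>g lie_End_scale[OF e],
          simp add: e_def pt_gen x0F \<phi>g x0 lie_End_zero[OF \<phi>])
    then have "\<phi> \<otimes>\<^bsub>lie_End X\<^esub> e' = e' \<otimes>\<^bsub>lie_End X\<^esub> \<phi>"
      using xi_mult[OF \<phi> e] xi_mult[OF e \<phi>] by (simp add: xi_\<phi> e'_def)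
    from fun_cong[OF this, of "gn x0"] show "\<phi> w = lscale (d ^ 1) w"
      by (simp add: lie_End_mult_apply x0F \<phi>g x0 lie_End_scale[OF e'] w_def)
  qed
  then have "w \<in> free_lie.span (lgen ` X)"
    using lie_homog_low_degree by blast
  moreover have "lgen ` X = insert (gn x0) (lgen ` (X - {x0}))"
    using x0 by auto
  ultimately obtain a where a: "w - lscale a (gn x0) \<in> free_lie.span (lgen ` (X - {x0}))" (is "?v \<in> _")
    using free_lie.span_insert[of "gn x0" "lgen ` (X - {x0})"] by auto
  have "g u = lscale c u \<and> u \<in> F" if "u \<in> free_lie.span (lgen ` (X - {x0}))" for u
    using that
  proof (induction rule: free_lie.span_induct_alt)
    case base
    show ?case by (simp add: lie_End_zero[OF g] free_lie_on.zero)
  next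
    case (step d y v)
    then show ?case
      by (auto simp: lie_End_add[OF g] lie_End_scale[OF g] g_gen free_lie_on.intros
          free_lie.scale_right_distrib mult.commute)
  qed
  note gv = this[OF a]
  have "g \<otimes>\<^bsub>lie_End X\<^esub> e = e"
    using mult_pt[OF g x0F] by (simp add: e_def g_gen x0)
  then have "g \<otimes>\<^bsub>lie_End X\<^esub> e' = e'"
    using xi_mult[OF g e] by (simp add: xi_g e'_def)
  from fun_cong[OF this, of "gn x0"] have "g w = w"
    by (simp add: lie_End_mult_apply x0F w_def)
  moreover have "g w = lscale a (gn x0) + g ?v"
    using lie_End_add[OF g, of "lscale a (gn x0)" ?v] gv
    by (simp add: free_lie_on.scale x0F lie_End_scale[OF g] g_gen x0)
  ultimately have "lscale (c - 1) ?v = 0"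
    using gv by (simp add: free_lie.scale_left_diff_distrib algebra_simps)
  then have w_eq: "w = lscale a (gn x0)"
    using c by simp
  have "e \<otimes>\<^bsub>lie_End X\<^esub> e = e"
    using mult_pt[OF e x0F] by (simp add: e_def pt_gen x0 x0F)
  then have "e' \<otimes>\<^bsub>lie_End X\<^esub> e' = e'"
    using xi_mult[OF e e] by (simp add: e'_def)
  from fun_cong[OF this, of "gn x0"] have "e' w = w"
    by (simp add: lie_End_mult_apply x0F w_def)
  moreover have "e' w = lscale a w"
    by (subst w_eq) (simp add: lie_End_scale[OF e'] x0F w_def)
  \<comment> \<open>Idempotency leaves \<open>a = 1\<close> or \<open>w = 0\<close>. In the second case \<open>e\<close> is zero by injectivity of \<open>\<xi>\<close>,
    so \<open>e' = e\<close> holds as well.\<close>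
  ultimately have "lscale (a - 1) w = 0"
    by (simp add: free_lie.scale_left_diff_distrib)
  then consider "a = 1" | "w = 0"
    by auto
  then have "e' = e"
  proof cases
    case 1
    then show ?thesis using e'_pt w_eq by (simp add: e_def)
  next
    case 2
    then have "\<xi> e = \<xi> (pt 0)"
      using e'_pt xi_pt_zero by (simp add: e'_def)
    then have "e = pt 0"
      using xi_inj[OF e pt_closed[OF free_lie_on.zero]] by simp
    then show ?thesis
      using e'_pt 2 by simp
  qed
  then show ?thesis
    by (simp add: e_def e'_def)
qed

text \<open>The bijection \<open>s\<close> of \<open>F(X)\<close> with \<open>\<xi> (pt u) = pt (s u)\<close>.\<close>

definition s :: "('x, 'p) free_lie \<Rightarrow> ('x, 'p) free_lie" where
  "s u = \<xi> (pt u) (gn x0)"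

lemma s_closed: "u \<in> F \<Longrightarrow> s u \<in> F"
  unfolding s_def by (rule lie_End_closed[OF xi_closed[OF pt_closed] free_lie_on.gen[OF x0]])

lemma xi_pt:
  assumes "u \<in> F"
  shows "\<xi> (pt u) = pt (s u)"
proof -
  have x0F: "gn x0 \<in> F"
    by (rule free_lie_on.gen[OF x0])
  have "pt u \<otimes>\<^bsub>lie_End X\<^esub> pt (gn x0) = pt u"
    using mult_pt[OF pt_closed[OF assms] x0F] by (simp add: pt_gen assms x0)
  then have "\<xi> (pt u) \<otimes>\<^bsub>lie_End X\<^esub> pt (gn x0) = \<xi> (pt u)"
    using xi_mult[OF pt_closed[OF assms] pt_closed[OF x0F]] by (simp add: xi_pt_gen)
  then show ?thesis
    unfolding s_def by (intro eq_pt_if xi_closed pt_closed assms)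
qed

lemma s_bij: "bij_betw s F F"
proof (rule bij_betwI')
  show "s u = s v \<longleftrightarrow> u = v" if "u \<in> F" "v \<in> F" for u v
  proof
    assume "s u = s v"
    then have "pt u = pt v"
      using xi_inj[of "pt u" "pt v"] that by (simp add: xi_pt pt_closed)
    from fun_cong[OF this, of "gn x0"] show "u = v"
      using that by (simp add: pt_gen x0)
  qed simp
  show "s u \<in> F" if "u \<in> F" for u
    using that by (rule s_closed)
  show "\<exists>u\<in>F. v = s u" if v: "v \<in> F" for v
  proof -
    have x0F: "gn x0 \<in> F"
      by (rule free_lie_on.gen[OF x0])
    obtain \<phi> where \<phi>: "\<phi> \<in> E" "\<xi> \<phi> = pt v"
      using xi_surj[OF pt_closed[OF v]] .
    have "\<xi> (\<phi> \<otimes>\<^bsub>lie_End X\<^esub> pt (gn x0)) = \<xi> \<phi>"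
      using xi_mult[OF \<phi>(1) pt_closed[OF x0F]] mult_pt[OF pt_closed[OF v] x0F]
      by (simp add: \<phi>(2) xi_pt_gen pt_gen v x0)
    then have "\<phi> = pt (\<phi> (gn x0))"
      using xi_inj lie_End_mult_closed[OF \<phi>(1) pt_closed[OF x0F]] \<phi>(1) eq_pt_if by blast
    then have "s (\<phi> (gn x0)) = v"
      using \<phi>(2) by (simp add: s_def pt_gen v x0)
    then show ?thesis
      using lie_End_closed[OF \<phi>(1) x0F] by auto
  qed
qed

text \<open>In other words, \<open>\<xi> \<phi>\<close> is the conjugate of \<open>\<phi>\<close> by \<open>s\<close>. Applied to a \<open>\<phi>\<close> that sends generators
  to given elements, this carries the values of \<open>s\<close> on words in the generators over to all
  elements.\<close>

lemma s_intertwines: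
  assumes "\<phi> \<in> E" "u \<in> F"
  shows "s (\<phi> u) = \<xi> \<phi> (s u)"
proof -
  have "pt (s (\<phi> u)) = pt (\<xi> \<phi> (s u))"
    using xi_mult[OF assms(1) pt_closed[OF assms(2)]] assms
    by (simp add: mult_pt xi_pt xi_closed s_closed lie_End_closed)
  from fun_cong[OF this, of "gn x0"] show ?thesis
    using assms by (simp add: pt_gen x0 s_closed xi_closed lie_End_closed)
qed

lemma s_linear_Aut: "g \<in> lie_Aut_lin X \<Longrightarrow> u \<in> F \<Longrightarrow> s (g u) = g (s u)"
  using s_intertwines[of g u] by (simp add: lie_Aut_lin_closed xi_linear)

lemma s_zero: "s 0 = 0"
  by (simp add: s_def xi_pt_zero pt_gen free_lie_on.zero x0)

lemma s_gen:
  assumes "x \<in> X"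
  shows "s (gn x) = gn x"
proof -
  have x0F: "gn x0 \<in> F"
    by (rule free_lie_on.gen[OF x0])
  have s0: "s (gn x0) = gn x0"
    by (simp add: s_def xi_pt_gen pt_gen x0F x0)
  have "lie_lift X (\<lambda>z. lgen (if z = x then x0 else if z = x0 then x else z)) (gn x0) = gn x"
    using assms x0 by (subst lie_lift_gen) (auto intro: free_lie_on.gen)
  with s_linear_Aut[OF transposition_lie_Aut_lin[OF assms x0] x0F] show ?thesis
    by (simp add: s0)
qed

lemma xi_gen: "\<phi> \<in> E \<Longrightarrow> x \<in> X \<Longrightarrow> \<xi> \<phi> (gn x) = s (\<phi> (gn x))"
  by (simp add: s_intertwines s_gen free_lie_on.gen)

lemma s_scale:
  assumes u: "u \<in> F"
  shows "s (lscale c u) = lscale c (s u)"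
proof (cases "c = 0")
  case True
  then show ?thesis by (simp add: s_zero)
next
  case False
  have x0F: "gn x0 \<in> F"
    by (rule free_lie_on.gen[OF x0])
  have "lie_lift X (\<lambda>x. lscale c (lgen x)) (gn x0) = lscale c (gn x0)"
    using x0 by (subst lie_lift_gen) (auto intro: free_lie_on.intros)
  with s_linear_Aut[OF diagonal_lie_Aut_lin[of X "\<lambda>_. c"] x0F] False
  have *: "s (lscale c (gn x0)) = lscale c (gn x0)"
    by (simp add: s_gen x0)
  have "s (lscale c u) = s (pt u (lscale c (gn x0)))"
    by (simp add: lie_End_scale[OF pt_closed[OF u]] x0F pt_gen u x0)
  also have "\<dots> = lscale c (s (pt u (gn x0)))"
    using s_intertwines[OF pt_closed[OF u] free_lie_on.scale[OF x0F]]
    by (simp add: * lie_End_scale[OF xi_closed[OF pt_closed[OF u]]] x0F xi_gen pt_closed u x0)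
  finally show ?thesis
    by (simp add: pt_gen u x0)
qed

text \<open>With a second generator \<open>y\<close>, additivity comes from \<open>s (x0 + y) = x0 + y\<close>; with a single
  generator, \<open>F(X)\<close> consists of the multiples of \<open>x0\<close>, which \<open>s\<close> fixes.\<close>

lemma s_add:
  assumes u: "u \<in> F" and v: "v \<in> F"
  shows "s (u + v) = s u + s v"
proof (cases "\<exists>y\<in>X. y \<noteq> x0")
  case True
  then obtain y where y: "y \<in> X" "y \<noteq> x0"
    by blast
  have x0F: "gn x0 \<in> F" and yF: "gn y \<in> F"
    using x0 y by (auto intro: free_lie_on.gen)
  have "lie_lift X (\<lambda>z. if z = x0 then lgen x0 + lgen y else lgen z) (gn x0) = gn x0 + gn y"
    using x0 y by (subst lie_lift_gen) (auto intro: free_lie_on.intros)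
  with s_linear_Aut[OF transvection_lie_Aut_lin[OF x0 y(1)] x0F] y(2)
  have *: "s (gn x0 + gn y) = gn x0 + gn y"
    by (simp add: s_gen x0)
  define \<phi> where "\<phi> = lie_lift X (\<lambda>z. if z = x0 then u else v)"
  have \<phi>: "\<phi> \<in> E" "\<phi> (gn x0) = u" "\<phi> (gn y) = v"
    unfolding \<phi>_def using x0 y u v by (auto simp: lie_lift_gen intro: lie_lift_closed)
  have "s (u + v) = s (\<phi> (gn x0 + gn y))"
    by (simp add: lie_End_add[OF \<phi>(1)] x0F yF \<phi>)
  also have "\<dots> = s u + s v"
    using s_intertwines[OF \<phi>(1) free_lie_on.add[OF x0F yF]]
    by (simp add: * lie_End_add[OF xi_closed[OF \<phi>(1)]] x0F yF xi_gen \<phi> x0 y)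
  finally show ?thesis .
next
  case False
  have "\<exists>c. u = lscale c (gn x0)" if "u \<in> F" for u
    using free_lie_on_singleton[of X x0 u] False that by auto
  then have "s u = u" if "u \<in> F" for u
    using that s_scale[OF free_lie_on.gen[OF x0]] s_gen[OF x0] by metis
  then show ?thesis
    using u v free_lie_on.add by metis
qed

lemma s_bracket: "\<exists>c. c \<noteq> 0 \<and> (\<forall>u\<in>F. \<forall>v\<in>F. s (lbracket u v) = lscale c (lbracket (s u) (s v)))"
proof (cases "\<exists>y\<in>X. y \<noteq> x0")
  case True
  then obtain y where y: "y \<in> X" "y \<noteq> x0"
    by blast
  have x0F: "gn x0 \<in> F" and yF: "gn y \<in> F"
    using x0 y by (auto intro: free_lie_on.gen)
  define b where "b = lbracket (gn x0) (gn y)"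
  have bF: "b \<in> F"
    unfolding b_def by (rule free_lie_on.bracket[OF x0F yF])
  have "lie_homog X 2 (s b)"
  proof (rule eigenvector_imp_lie_homog[OF inf s_closed[OF bF]])
    fix d \<phi>
    assume "d \<noteq> 0" and \<phi>: "\<phi> \<in> E" and \<phi>g: "\<And>x. x \<in> X \<Longrightarrow> \<phi> (gn x) = lscale d (gn x)"
    have "\<xi> \<phi> = \<phi>"
      by (rule lie_End_eqI_gen[OF xi_closed[OF \<phi>] \<phi>])
        (simp add: xi_gen \<phi> \<phi>g s_scale s_gen free_lie_on.gen)
    then have "\<phi> (s b) = s (\<phi> b)"
      using s_intertwines[OF \<phi> bF] by simp
    also have "\<phi> b = lscale (d ^ 2) b"
      unfolding b_def
      by (simp add: lie_End_bracket[OF \<phi>] x0F yF \<phi>g x0 y free_lie.bracket_scale_left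
          free_lie.bracket_scale_right power2_eq_square)
    finally show "\<phi> (s b) = lscale (d ^ 2) (s b)"
      by (simp add: s_scale bF)
  qed
  then have sb: "s b \<in> free_lie.span {lbracket a b |a b. a \<in> lgen ` X \<and> b \<in> lgen ` X}"
    using lie_homog_low_degree by blast
  \<comment> \<open>The projection \<open>k\<close> onto the generators \<open>x0\<close> and \<open>y\<close> fixes \<open>s b\<close>, so only the brackets of these
    two generators contribute.\<close>
  define k where "k = lie_lift X (\<lambda>z. if z = x0 \<or> z = y then gn z else 0)"
  have k: "k \<in> E" "\<And>z. z \<in> X \<Longrightarrow> k (gn z) = (if z = x0 \<or> z = y then gn z else 0)"
    unfolding k_def by (auto simp: lie_lift_gen free_lie_on.intros intro!: lie_lift_closed)
  have "\<xi> k = k"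
    by (rule lie_End_eqI_gen[OF xi_closed[OF k(1)] k(1)]) (simp add: xi_gen k s_gen s_zero)
  then have k_sb: "k (s b) = s b"
    using s_intertwines[OF k(1) bF] by (simp add: b_def lie_End_bracket[OF k(1)] x0F yF k x0 y)
  have "(\<exists>c. k u = lscale c b) \<and> u \<in> F"
    if "u \<in> free_lie.span {lbracket a b |a b. a \<in> lgen ` X \<and> b \<in> lgen ` X}" for u
    using that
  proof (induction rule: free_lie.span_induct_alt)
    case base
    show ?case
      by (auto simp: lie_End_zero[OF k(1)] intro: exI[of _ 0] free_lie_on.zero)
  next
    case (step c w v)
    then obtain d z z' where w: "w = lbracket (gn z) (gn z')" and z: "z \<in> X" "z' \<in> X"
      and v: "k v = lscale d b" "v \<in> F"
      by auto
    have wF: "w \<in> F"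
      unfolding w by (intro free_lie_on.bracket free_lie_on.gen z)
    have "lbracket (gn y) (gn x0) = lscale (- 1) b"
      using lbracket_antisym[of "gn y" "gn x0"] by (simp add: b_def)
    then have "k w \<in> {0, lscale 1 b, lscale (- 1) b}"
      unfolding w using z
      by (auto simp: lie_End_bracket[OF k(1)] free_lie_on.gen k(2) b_def free_lie.bracket_self)
    then obtain d' where "k w = lscale d' b"
      using free_lie.scale_zero_left by (metis insertE singletonD)
    then have "k (lscale c w + v) = lscale (c * d' + d) b"
      by (simp add: lie_End_add[OF k(1)] lie_End_scale[OF k(1)] wF v free_lie_on.scale
          free_lie.scale_left_distrib)
    then show ?case
      using wF v by (auto intro: free_lie_on.intros)
  qed
  from this[OF sb] obtain c where c: "s b = lscale c b"
    unfolding k_sb by blast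
  have br: "s (lbracket u v) = lscale c (lbracket (s u) (s v)) \<and> (b = 0 \<longrightarrow> lbracket u v = 0)"
    if u: "u \<in> F" and v: "v \<in> F" for u v
  proof -
    define \<phi> where "\<phi> = lie_lift X (\<lambda>z. if z = x0 then u else v)"
    have \<phi>: "\<phi> \<in> E" "\<phi> (gn x0) = u" "\<phi> (gn y) = v"
      unfolding \<phi>_def using x0 y u v by (auto simp: lie_lift_gen intro: lie_lift_closed)
    have \<phi>b: "\<phi> b = lbracket u v"
      by (simp add: b_def lie_End_bracket[OF \<phi>(1)] x0F yF \<phi>)
    have "s (lbracket u v) = \<xi> \<phi> (lscale c b)"
      using s_intertwines[OF \<phi>(1) bF] by (simp add: c \<phi>b)
    also have "\<dots> = lscale c (lbracket (s u) (s v))"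
      unfolding lie_End_scale[OF xi_closed[OF \<phi>(1)] bF]
      by (simp add: b_def lie_End_bracket[OF xi_closed[OF \<phi>(1)]] x0F yF xi_gen \<phi> x0 y)
    finally show ?thesis
      using \<phi>b lie_End_zero[OF \<phi>(1)] by auto
  qed
  show ?thesis
  proof (cases "c = 0")
    case True
    \<comment> \<open>Injectivity of \<open>s\<close> then gives \<open>b = 0\<close>, so all brackets vanish and the scalar \<open>1\<close> will do.\<close>
    then have "s b = s 0"
      by (simp add: c s_zero)
    then have "b = 0"
      using s_bij bF free_lie_on.zero by (auto simp: bij_betw_def dest: inj_onD)
    then show ?thesis
      using br s_closed s_zero by (intro exI[of _ 1]) simp
  qed (use br in blast)
next
  case False
  have "lbracket u v = 0" if "u \<in> F" "v \<in> F" for u v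
  proof -
    obtain c d where "u = lscale c (gn x0)" "v = lscale d (gn x0)"
      using free_lie_on_singleton[of X x0 u] free_lie_on_singleton[of X x0 v]
        False \<open>u \<in> F\<close> \<open>v \<in> F\<close> by auto
    then show ?thesis
      by (simp add: free_lie.bracket_scale_left free_lie.bracket_scale_right free_lie.bracket_self)
  qed
  then show ?thesis
    using s_closed s_zero by (intro exI[of _ 1]) simp
qed

text \<open>The map \<open>c s\<close> respects brackets: \<open>c s [u, v] = c\<^sup>2 [s u, s v] = [c s u, c s v]\<close>.\<close>

lemma inner:
  "\<exists>f\<in>lie_Aut X. \<forall>\<phi>\<in>E. \<xi> \<phi> = f \<otimes>\<^bsub>lie_End X\<^esub> \<phi> \<otimes>\<^bsub>lie_End X\<^esub> inv\<^bsub>lie_End X\<^esub> f"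
proof -
  obtain c where c: "c \<noteq> 0"
    and br: "\<And>u v. u \<in> F \<Longrightarrow> v \<in> F \<Longrightarrow> s (lbracket u v) = lscale c (lbracket (s u) (s v))"
    using s_bracket by blast
  define f where "f = (\<lambda>u\<in>F. lscale c (s u))"
  have f: "f \<in> E"
    unfolding f_def
    by (rule lie_EndI)
      (simp_all add: s_closed free_lie_on.scale s_add free_lie.scale_right_distrib s_scale mult.commute
        br free_lie.bracket_scale_left free_lie.bracket_scale_right)
  have "bij_betw (lscale c) F F"
    by (rule bij_betw_byWitness[where f' = "lscale (inverse c)"])
      (use c in \<open>auto intro: free_lie_on.scale\<close>)
  then have "bij_betw (lscale c \<circ> s) F F"
    by (rule bij_betw_trans[OF s_bij])
  then have "bij_betw f F F"
    by (rule bij_betw_cong[THEN iffD1, rotated]) (simp add: f_def)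
  then have fA: "f \<in> lie_Aut X"
    by (rule bij_in_lie_Aut[OF f])
  interpret M: monoid "lie_End X :: (('x, 'p) free_lie \<Rightarrow> ('x, 'p) free_lie) monoid"
    by (rule monoid_lie_End)
  have fU: "f \<in> Units (lie_End X)"
    using fA by (simp add: lie_Aut_def)
  have "\<xi> \<phi> = f \<otimes>\<^bsub>lie_End X\<^esub> \<phi> \<otimes>\<^bsub>lie_End X\<^esub> inv\<^bsub>lie_End X\<^esub> f" if \<phi>: "\<phi> \<in> E" for \<phi>
  proof -
    have "f \<otimes>\<^bsub>lie_End X\<^esub> \<phi> = \<xi> \<phi> \<otimes>\<^bsub>lie_End X\<^esub> f"
    proof (rule lie_End_eqI[OF lie_End_mult_closed[OF f \<phi>] lie_End_mult_closed[OF xi_closed[OF \<phi>] f]])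
      show "(f \<otimes>\<^bsub>lie_End X\<^esub> \<phi>) u = (\<xi> \<phi> \<otimes>\<^bsub>lie_End X\<^esub> f) u" if "u \<in> F" for u
        using that
        by (simp add: lie_End_mult_apply f_def lie_End_closed[OF \<phi>] s_intertwines[OF \<phi>]
            lie_End_scale[OF xi_closed[OF \<phi>]] s_closed)
    qed
    then have "f \<otimes>\<^bsub>lie_End X\<^esub> \<phi> \<otimes>\<^bsub>lie_End X\<^esub> inv\<^bsub>lie_End X\<^esub> f =
        \<xi> \<phi> \<otimes>\<^bsub>lie_End X\<^esub> (f \<otimes>\<^bsub>lie_End X\<^esub> inv\<^bsub>lie_End X\<^esub> f)"
      using xi_closed[OF \<phi>] f fU by (simp add: M.m_assoc)
    then show ?thesis
      using xi_closed[OF \<phi>] fU by simp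
  qed
  then show ?thesis
    using fA by blast
qed

end

theorem corollary3p8:
  fixes X :: "'x set"
    and \<xi> :: "(('x, 'p::field) free_lie \<Rightarrow> ('x, 'p) free_lie)
                \<Rightarrow> (('x, 'p) free_lie \<Rightarrow> ('x, 'p) free_lie)"
  assumes "infinite (UNIV :: 'p set)"
    and "finite X"
    and "\<xi> \<in> iso (lie_End X) (lie_End X)"
    and "linearly_stable X \<xi>"
  shows "\<exists>f\<in>lie_Aut X. \<forall>\<phi>\<in>carrier (lie_End X).
           \<xi> \<phi> = f \<otimes>\<^bsub>lie_End X\<^esub> \<phi> \<otimes>\<^bsub>lie_End X\<^esub> inv\<^bsub>lie_End X\<^esub> f"
proof (cases "X = {}")
  case True
  interpret M: monoid "lie_End X :: (('x, 'p) free_lie \<Rightarrow> ('x, 'p) free_lie) monoid"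
    by (rule monoid_lie_End)
  have "\<xi> \<phi> \<in> carrier (lie_End X)" if "\<phi> \<in> carrier (lie_End X)" for \<phi>
    using assms(3) that by (auto simp: iso_def hom_def)
  moreover have "\<phi> = \<psi>" if "\<phi> \<in> carrier (lie_End X)" "\<psi> \<in> carrier (lie_End X)"
    for \<phi> \<psi> :: "('x, 'p) free_lie \<Rightarrow> ('x, 'p) free_lie"
    by (rule lie_End_eqI_gen[OF that]) (simp add: True)
  \<comment> \<open>Without generators, the semigroup has a single element.\<close>
  ultimately show ?thesis
    by (intro bexI[of _ "\<one>\<^bsub>lie_End X\<^esub>"]) (auto simp: lie_Aut_def)
next
  case False
  then obtain x0 where "x0 \<in> X"
    by blast
  then interpret linearly_stable_iso X \<xi> x0
    using assms by unfold_locales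
  show ?thesis
    by (rule inner)
qed

end
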